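(* Let $L$ be a hyperabelian Lie algebra over a field $F$. Then every abelian subideal of $L$ is an ideal of $L$ if and only if every subideal of $L$ is an ideal of $L$.
   Context: A Lie algebra $L$ (of arbitrary dimension) is hyperabelian if it has an ascending (possibly transfinite) series of ideals, from $\langle 0\rangle$ to $L$, whose factors are abelian. A subalgebra $S$ of $L$ is a subideal if there is a finite chain $S = S_0 \leq S_1 \leq \cdots \leq S_n = L$ of subalgebras with each $S_i$ an ideal of $S_{i+1}$. *)

theory Defs
  imports Complex_Main "HOL-Library.Set_Algebras"
begin

locale lie_algebra = vector_space scale
  for scale :: "'f::field \<Rightarrow> 'a::ab_group_add \<Rightarrow> 'a" (infixr \<open>*s\<close> 75) +
  fixes bracket :: "'a \<Rightarrow> 'a \<Rightarrow> 'a"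
  assumes linear_bracket_left: "Vector_Spaces.linear scale scale (\<lambda>x. bracket x y)"
    and linear_bracket_right: "Vector_Spaces.linear scale scale (bracket x)"
    and bracket_self: "bracket x x = 0"
    and jacobi: "bracket x (bracket y z) + bracket y (bracket z x) + bracket z (bracket x y) = 0"
begin

definition subalgebra :: "'a set \<Rightarrow> bool" where
  "subalgebra S \<longleftrightarrow> subspace S \<and> (\<forall>x\<in>S. \<forall>y\<in>S. bracket x y \<in> S)"

definition ideal_of :: "'a set \<Rightarrow> 'a set \<Rightarrow> bool" where
  "ideal_of I S \<longleftrightarrow> I \<subseteq> S \<and> subspace I \<and> (\<forall>x\<in>S. \<forall>y\<in>I. bracket x y \<in> I)"

abbreviation ideal :: "'a set \<Rightarrow> bool" where
  "ideal I \<equiv> ideal_of I UNIV"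

definition abelian :: "'a set \<Rightarrow> bool" where
  "abelian S \<longleftrightarrow> (\<forall>x\<in>S. \<forall>y\<in>S. bracket x y = 0)"

definition subideal :: "'a set \<Rightarrow> bool" where
  "subideal S \<longleftrightarrow>
    (\<exists>(n::nat) T. T 0 = S \<and> T n = UNIV \<and> (\<forall>i\<le>n. subalgebra (T i)) \<and>
      (\<forall>i<n. ideal_of (T i) (T (Suc i))))"

text \<open>The factor \<open>J / I\<close> is abelian: the product \<open>bracket x y +o I\<close> of any two cosets
  \<open>x +o I\<close> and \<open>y +o I\<close> with \<open>x\<close>, \<open>y\<close> in \<open>J\<close> is the zero coset \<open>I\<close>.\<close>

definition abelian_factor :: "'a set \<Rightarrow> 'a set \<Rightarrow> bool" where
  "abelian_factor J I \<longleftrightarrow> (\<forall>x\<in>J. \<forall>y\<in>J. bracket x y +o I = I)"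

text \<open>A transfinite series is indexed by the field of a well-order with a greatest element,
  which plays the role of the ordinals up to and including some ordinal. An index \<open>k\<close> is the
  successor of \<open>i\<close> iff \<open>underS r k = under r i\<close>; it is a limit iff it has predecessors but is
  not a successor.\<close>

definition abelian_ideal_series :: "'i rel \<Rightarrow> ('i \<Rightarrow> 'a set) \<Rightarrow> bool" where
  "abelian_ideal_series r V \<longleftrightarrow>
    Well_order r \<and>
    (\<forall>i\<in>Field r. ideal (V i)) \<and>
    (\<forall>i\<in>Field r. underS r i = {} \<longrightarrow> V i = {0}) \<and>
    (\<forall>i\<in>Field r. \<forall>k\<in>Field r. underS r k = under r i \<longrightarrow>
       V i \<subseteq> V k \<and> abelian_factor (V k) (V i)) \<and>
    (\<forall>k\<in>Field r. underS r k \<noteq> {} \<and> \<not> (\<exists>i\<in>Field r. underS r k = under r i) \<longrightarrow>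
       V k = (\<Union>i\<in>underS r k. V i)) \<and>
    (\<exists>m\<in>Field r. (\<forall>i\<in>Field r. (i, m) \<in> r) \<and> V m = UNIV)"

text \<open>Indices are taken in \<^typ>\<open>'a set\<close> because a definition cannot quantify over types; this
  loses no generality, as the lemma \<open>hyperabelianI\<close> below shows.\<close>

definition hyperabelian :: bool where
  "hyperabelian \<longleftrightarrow>
    (\<exists>(r :: 'a set rel) V. abelian_ideal_series r V)"

lemma coset_eq_self_iff:
  assumes "subspace I"
  shows "x +o I = I \<longleftrightarrow> x \<in> I"
proof
  assume "x +o I = I"
  moreover have "x + 0 \<in> x +o I"
    using assms subspace_0 by (metis set_plus_intro2)
  ultimately show "x \<in> I" by simp
next
  assume x: "x \<in> I"
  show "x +o I = I"
  proof
    show "x +o I \<subseteq> I"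
      using x assms subspace_add by (auto simp: elt_set_plus_def)
    show "I \<subseteq> x +o I"
    proof
      fix y assume "y \<in> I"
      then have "y - x \<in> I" using x assms subspace_diff by blast
      then have "x + (y - x) \<in> x +o I" by (rule set_plus_intro2)
      then show "y \<in> x +o I" by simp
    qed
  qed
qed

lemma abelian_factor_iff:
  "subspace I \<Longrightarrow> abelian_factor J I \<longleftrightarrow> (\<forall>x\<in>J. \<forall>y\<in>J. bracket x y \<in> I)"
  by (simp add: abelian_factor_def coset_eq_self_iff)

lemma abelian_ideal_series_mono:
  assumes s: "abelian_ideal_series r V" and ik: "(i, k) \<in> r"
  shows "V i \<subseteq> V k"
proof -
  have wo: "wo_rel r" using s by (simp add: abelian_ideal_series_def wo_rel_def)
  have "\<forall>i. (i, k) \<in> r \<longrightarrow> V i \<subseteq> V k"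
  proof (rule wo_rel.well_order_induct[OF wo, where P = "\<lambda>k. \<forall>i. (i, k) \<in> r \<longrightarrow> V i \<subseteq> V k"],
      intro allI impI)
    fix k i
    assume IH: "\<forall>j. j \<noteq> k \<and> (j, k) \<in> r \<longrightarrow> (\<forall>i. (i, j) \<in> r \<longrightarrow> V i \<subseteq> V j)"
      and ik: "(i, k) \<in> r"
    show "V i \<subseteq> V k"
    proof (cases "i = k")
      case False
      have F: "i \<in> Field r" "k \<in> Field r" using ik by (auto simp: Field_def)
      have iu: "i \<in> underS r k" using ik False by (simp add: underS_def)
      show ?thesis
      proof (cases "\<exists>j\<in>Field r. underS r k = under r j")
        case True
        then obtain j where j: "j \<in> Field r" "underS r k = under r j" by blast
        have ij: "(i, j) \<in> r" using iu j by (simp add: under_def)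
        have "(j, j) \<in> r" using wo_rel.REFL[OF wo] j(1) by (auto simp: refl_on_def)
        then have "j \<in> underS r k" using j by (simp add: under_def)
        then have "V i \<subseteq> V j" using IH ij by (auto simp: underS_def)
        moreover have "V j \<subseteq> V k"
          using s j F unfolding abelian_ideal_series_def by blast
        ultimately show ?thesis by blast
      next
        case False
        then have "V k = (\<Union>i\<in>underS r k. V i)"
          using s F iu unfolding abelian_ideal_series_def by blast
        then show ?thesis using iu by blast
      qed
    qed simp
  qed
  then show ?thesis using ik by blast
qed

lemma hyperabelianI:
  fixes r :: "'i rel"
  assumes s: "abelian_ideal_series r V"
  shows hyperabelian
proof -
  have wo: "wo_rel r" using s by (simp add: abelian_ideal_series_def wo_rel_def)
  have tot: "\<And>i j. i \<in> Field r \<Longrightarrow> j \<in> Field r \<Longrightarrow> (i, j) \<in> r \<or> (j, i) \<in> r"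
    using wo_rel.TOTALS[OF wo] by blast
  note c = s[unfolded abelian_ideal_series_def]
  note c2 = c[THEN conjunct2]
  note c3 = c2[THEN conjunct2]
  note c4 = c3[THEN conjunct2]
  note c5 = c4[THEN conjunct2]
  have id: "\<And>i. i \<in> Field r \<Longrightarrow> ideal (V i)"
    using c2[THEN conjunct1] by simp
  have zero: "\<And>i. i \<in> Field r \<Longrightarrow> underS r i = {} \<Longrightarrow> V i = {0}"
    using c3[THEN conjunct1] by simp
  have step: "\<And>i k. i \<in> Field r \<Longrightarrow> k \<in> Field r \<Longrightarrow> underS r k = under r i \<Longrightarrow>
       V i \<subseteq> V k \<and> abelian_factor (V k) (V i)"
    using c4[THEN conjunct1] by simp
  have lim: "\<And>k. k \<in> Field r \<Longrightarrow> underS r k \<noteq> {} \<Longrightarrow>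
       \<not> (\<exists>i\<in>Field r. underS r k = under r i) \<Longrightarrow> V k = (\<Union>i\<in>underS r k. V i)"
    using c5[THEN conjunct1] by blast
  obtain m where m: "m \<in> Field r" "V m = UNIV"
    using c5[THEN conjunct2] by blast
  have mono: "\<And>i k. (i, k) \<in> r \<Longrightarrow> V i \<subseteq> V k"
    using abelian_ideal_series_mono[OF s] .
  define M where "M = V ` Field r"
  define r' where "r' = {(A, B). A \<in> M \<and> B \<in> M \<and> A \<subseteq> B}"
  define \<iota> where "\<iota> A = wo_rel.minim r {i \<in> Field r. V i = A}" for A
  have \<iota>: "\<iota> A \<in> Field r" "V (\<iota> A) = A" if "A \<in> M" for A
    using wo_rel.minim_in[OF wo, of "{i \<in> Field r. V i = A}"] that
    by (auto simp: \<iota>_def M_def)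
  have least: "(\<iota> A, i) \<in> r" if "i \<in> Field r" "V i = A" for A i
    using wo_rel.minim_least[OF wo, of "{i \<in> Field r. V i = A}" i] that
    by (auto simp: \<iota>_def)
  have below: "V i \<subset> A" if "A \<in> M" "i \<in> underS r (\<iota> A)" for A i
  proof -
    have i: "(i, \<iota> A) \<in> r" "i \<noteq> \<iota> A" "i \<in> Field r"
      using that by (auto simp: underS_def Field_def)
    have "V i \<subseteq> A" using mono[OF i(1)] \<iota>[OF that(1)] by simp
    moreover have "V i \<noteq> A"
      using least[OF i(3)] i wo_rel.ANTISYM[OF wo] by (auto simp: antisym_def)
    ultimately show ?thesis by blast
  qed
  have strict: "(\<iota> A, \<iota> B) \<in> r - Id" if "A \<in> M" "B \<in> M" "A \<subset> B" for A B
  proof -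
    have "(\<iota> B, \<iota> A) \<notin> r"
      using mono[of "\<iota> B" "\<iota> A"] \<iota>(2)[OF that(1)] \<iota>(2)[OF that(2)] that(3) by auto
    then have "(\<iota> A, \<iota> B) \<in> r" "(\<iota> B, \<iota> B) \<in> r"
      using tot[OF \<iota>(1)[OF that(1)] \<iota>(1)[OF that(2)]]
        tot[OF \<iota>(1)[OF that(2)] \<iota>(1)[OF that(2)]] by simp_all
    with \<open>(\<iota> B, \<iota> A) \<notin> r\<close> show ?thesis by (metis DiffI pair_in_Id_conv)
  qed
  have chain: "A \<subseteq> B \<or> B \<subseteq> A" if "A \<in> M" "B \<in> M" for A B
    using tot[OF \<iota>(1)[OF that(1)] \<iota>(1)[OF that(2)]] mono[of "\<iota> A" "\<iota> B"]
      mono[of "\<iota> B" "\<iota> A"] \<iota>(2)[OF that(1)] \<iota>(2)[OF that(2)] by metis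
  have F': "Field r' = M" by (auto simp: r'_def Field_def)
  have "wf (r' - Id)"
  proof (rule wf_subset[OF wf_inv_image[OF wo_rel.WF[OF wo], of \<iota>]])
    show "r' - Id \<subseteq> inv_image (r - Id) \<iota>"
      using strict unfolding r'_def inv_image_def by blast
  qed
  then have wo': "Well_order r'"
    using chain unfolding order_on_defs F'
    by (auto simp: r'_def refl_on_def trans_def antisym_def total_on_def)
  have under': "under r' A = {B \<in> M. B \<subseteq> A}" "underS r' A = {B \<in> M. B \<subset> A}" if "A \<in> M" for A
    using that by (auto simp: r'_def under_def underS_def)
  have zin: "0 \<in> A" if "A \<in> M" for A
    using that id subspace_0 unfolding M_def ideal_of_def by blast
  have zM: "{0} \<in> M"
  proof -
    obtain z where z: "z \<in> Field r" "\<forall>i\<in>Field r. (z, i) \<in> r"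
      using wo_rel.minim_in[OF wo, of "Field r"] wo_rel.minim_least[OF wo, of "Field r"] m
      by blast
    have "underS r z = {}"
      using z wo_rel.ANTISYM[OF wo] by (auto simp: underS_def antisym_def Field_def)
    then show ?thesis using zero z unfolding M_def by (metis imageI)
  qed
  have nz: "underS r (\<iota> A) \<noteq> {}" if "A \<in> M" "A \<noteq> {0}" for A
    using zero[of "\<iota> A"] \<iota>[OF that(1)] that(2) by auto
  have "abelian_ideal_series r' (\<lambda>A. A)"
    unfolding abelian_ideal_series_def F'
  proof (intro conjI ballI impI)
    show "well_order_on M r'" using wo' unfolding F' .
    show "ideal A" if "A \<in> M" for A using that id unfolding M_def by blast
    show "A = {0}" if "A \<in> M" "underS r' A = {}" for A
      using under'(2)[OF that(1)] that zM zin[OF that(1)] by blast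
    show "A \<subseteq> C" if "A \<in> M" "C \<in> M" "underS r' C = under r' A" for A C
    proof -
      have "A \<in> underS r' C" using under'(1)[OF that(1)] that by simp
      then show ?thesis using under'(2)[OF that(2)] by auto
    qed
    show "abelian_factor C A" if A: "A \<in> M" and C: "C \<in> M" and e: "underS r' C = under r' A" for A C
    proof -
      have e': "B \<subset> C \<longleftrightarrow> B \<subseteq> A" if "B \<in> M" for B
      proof -
        have "B \<in> underS r' C \<longleftrightarrow> B \<in> under r' A" using e by simp
        then show ?thesis using under'(1)[OF A] under'(2)[OF C] that by simp
      qed
      have AC: "A \<subset> C" using e'[OF A] by blast
      have "C \<noteq> {0}" using AC zin[OF A] by blast
      then have ne: "underS r (\<iota> C) \<noteq> {}" using nz[OF C] by blast
      have le: "V i \<subseteq> A" if "i \<in> underS r (\<iota> C)" for i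
        using below[OF C that] e'[of "V i"] that by (auto simp: M_def underS_def Field_def)
      have "\<exists>i\<in>Field r. underS r (\<iota> C) = under r i"
      proof (rule ccontr)
        assume "\<not> ?thesis"
        then have "C = (\<Union>i\<in>underS r (\<iota> C). V i)"
          using lim[OF \<iota>(1)[OF C] ne] \<iota>(2)[OF C] by simp
        then show False using le AC by blast
      qed
      then obtain i where i: "i \<in> Field r" "underS r (\<iota> C) = under r i" by blast
      have "(i, i) \<in> r" using tot[OF i(1) i(1)] by blast
      then have "V i \<subseteq> A" using le[of i] i by (simp add: under_def)
      moreover have "abelian_factor C (V i)"
        using step[OF i(1) \<iota>(1)[OF C] i(2)] \<iota>(2)[OF C] by simp
      moreover have "subspace (V i)" using id[OF i(1)] by (simp add: ideal_of_def)
      moreover have "subspace A" using A id unfolding M_def ideal_of_def by blast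
      ultimately show ?thesis by (auto simp: abelian_factor_iff)
    qed
    show "C = (\<Union>A\<in>underS r' C. A)"
      if C: "C \<in> M" and l: "underS r' C \<noteq> {} \<and> \<not> (\<exists>A\<in>M. underS r' C = under r' A)" for C
    proof -
      have "C \<noteq> {0}" using l under'(2)[OF C] zin by blast
      then have ne: "underS r (\<iota> C) \<noteq> {}" using nz[OF C] by blast
      have "\<not> (\<exists>i\<in>Field r. underS r (\<iota> C) = under r i)"
      proof
        assume "\<exists>i\<in>Field r. underS r (\<iota> C) = under r i"
        then obtain i where i: "i \<in> Field r" "underS r (\<iota> C) = under r i" by blast
        have "(i, i) \<in> r" using tot[OF i(1) i(1)] by blast
        then have iC: "V i \<subset> C" using below[OF C, of i] i by (simp add: under_def)
        have iM: "V i \<in> M" using i by (simp add: M_def)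
        have "B \<subset> C \<longleftrightarrow> B \<subseteq> V i" if B: "B \<in> M" for B
        proof
          assume "B \<subset> C"
          then have "\<iota> B \<in> under r i" using strict[OF B C] i(2) by (auto simp: underS_def)
          then show "B \<subseteq> V i" using mono[of "\<iota> B" i] \<iota>(2)[OF B] by (simp add: under_def)
        qed (use iC in blast)
        then have "{B \<in> M. B \<subset> C} = {B \<in> M. B \<subseteq> V i}" by (intro Collect_cong) auto
        then have "underS r' C = under r' (V i)"
          by (simp only: under'(1)[OF iM] under'(2)[OF C])
        then show False using l iM by blast
      qed
      then have "C = (\<Union>i\<in>underS r (\<iota> C). V i)"
        using lim[OF \<iota>(1)[OF C] ne] \<iota>(2)[OF C] by simp
      moreover have "V i \<in> underS r' C" if i: "i \<in> underS r (\<iota> C)" for i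
      proof -
        have "V i \<in> M" using i by (auto simp: M_def underS_def Field_def)
        then show ?thesis using below[OF C i] by (simp add: under'(2)[OF C])
      qed
      then have "(\<Union>i\<in>underS r (\<iota> C). V i) \<subseteq> (\<Union>A\<in>underS r' C. A)" by (intro UN_least UN_upper)
      moreover have "(\<Union>A\<in>underS r' C. A) \<subseteq> C"
        by (rule UN_least) (auto simp: under'(2)[OF C])
      ultimately show ?thesis by (metis subset_antisym)
    qed
    have "UNIV \<in> M" using m unfolding M_def by (metis imageI)
    then show "\<exists>A\<in>M. (\<forall>B\<in>M. (B, A) \<in> r') \<and> A = UNIV" by (auto simp: r'_def)
  qed
  then show ?thesis unfolding hyperabelian_def by blast
qed

end

end

(* Let every abelian subideal of L be an ideal, and let A be the set of all a for which the line F a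
   is an ideal.  Then A is an abelian ideal on which each element of L acts as a scalar.  If x lies in
   the centralizer C of A and in a term V of the series, and products of elements of C \<inter> V lie
   in A, then F x is an ideal of F x + (A \<inter> V), which is an ideal of C \<inter> V, so x is in A.
   Hence C = A by transfinite induction.  Comparing scalars, any y outside A satisfies L = A + F y and
   acts invertibly on A, so the only subideal containing y is L; a subideal inside A is
   invariant because L acts by scalars. *)

theory Submission
  imports Defs
begin

context lie_algebra
begin

section \<open>Bilinearity and antisymmetry of the bracket\<close>

lemma bracket_add_left: "bracket (x + y) z = bracket x z + bracket y z"
  using linear_bracket_left[of z] module_hom.add[of scale scale "\<lambda>x. bracket x z"]
  by (simp add: linear_iff_module_hom)

lemma bracket_scale_left: "bracket (c *s x) z = c *s bracket x z"
  using linear_bracket_left[of z] module_hom.scale[of scale scale "\<lambda>x. bracket x z"]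
  by (simp add: linear_iff_module_hom)

lemma bracket_add_right: "bracket z (x + y) = bracket z x + bracket z y"
  using linear_bracket_right[of z] by (simp add: linear_iff_module_hom module_hom.add)

lemma bracket_scale_right: "bracket z (c *s x) = c *s bracket z x"
  using linear_bracket_right[of z] by (simp add: linear_iff_module_hom module_hom.scale)

lemma bracket_zero_left: "bracket 0 z = 0"
  using bracket_add_left[of 0 0 z] by simp

lemma bracket_zero_right: "bracket z 0 = 0"
  using bracket_add_right[of z 0 0] by simp

lemma bracket_anti: "bracket x y = - bracket y x"
proof -
  have "bracket (x + y) (x + y) = 0" by (rule bracket_self)
  then have "bracket x y + bracket y x = 0"
    unfolding bracket_add_left bracket_add_right by (simp add: bracket_self add.commute)
  then show ?thesis by (simp add: eq_neg_iff_add_eq_0)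
qed

lemma bracket_minus_left: "bracket (- x) z = - bracket x z"
  using bracket_scale_left[of "- 1" x z] by simp

lemma bracket_diff_left: "bracket (x - y) z = bracket x z - bracket y z"
  using bracket_add_left[of x "- y" z] by (simp add: bracket_minus_left)

section \<open>Chains of subideals\<close>

lemma ideal_of_imp_subalgebra: "ideal_of I S \<Longrightarrow> subalgebra I"
  by (auto simp: ideal_of_def subalgebra_def)

lemma subideal_UNIV: "subideal UNIV"
  unfolding subideal_def
  by (rule exI[of _ 0], rule exI[of _ "\<lambda>_. UNIV"]) (simp add: subalgebra_def)

lemma subideal_step:
  assumes I: "ideal_of I S" and S: "subideal S"
  shows "subideal I"
proof -
  obtain n T where T: "T 0 = S" "T n = UNIV" "\<And>i. i \<le> n \<Longrightarrow> subalgebra (T i)"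
    "\<And>i. i < n \<Longrightarrow> ideal_of (T i) (T (Suc i))"
    using S unfolding subideal_def by blast
  show ?thesis
    unfolding subideal_def
    \<comment> \<open>\<open>case_nat I T\<close> puts \<open>I\<close> in front of the chain of
      \<open>S\<close> and shifts every other term by one index.\<close>
    by (rule exI[of _ "Suc n"], rule exI[of _ "case_nat I T"])
      (use T I ideal_of_imp_subalgebra in \<open>auto split: nat.splits simp: less_Suc_eq_0_disj\<close>)
qed

lemma subideal_subspace: "subideal S \<Longrightarrow> subspace S"
  unfolding subideal_def subalgebra_def by blast

lemma subideal_if_ideal: "ideal I \<Longrightarrow> subideal I"
  using subideal_step subideal_UNIV by blast

lemma abelian_span_singleton: "abelian (span {x})"
  by (auto simp: abelian_def span_singleton bracket_scale_left bracket_scale_right bracket_self)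

text \<open>All terms of a chain from \<open>S\<close> to L contain \<open>y\<close>. Going down
  from the top, a term whose successor is L is an ideal of L containing \<open>y\<close>, hence is L
  itself, so the whole chain collapses.\<close>

lemma subideal_eq_UNIV:
  assumes S: "subideal S" and y: "y \<in> S" and gen: "\<And>I. ideal I \<Longrightarrow> y \<in> I \<Longrightarrow> I = UNIV"
  shows "S = UNIV"
proof -
  obtain n T where T: "T 0 = S" "T n = UNIV" "\<And>i. i < n \<Longrightarrow> ideal_of (T i) (T (Suc i))"
    using S unfolding subideal_def by blast
  have step: "T i \<subseteq> T (Suc i)" if "i < n" for i
    using T(3)[OF that] by (simp add: ideal_of_def)
  have up: "i \<le> n \<Longrightarrow> y \<in> T i" for i
    by (induction i) (use step T(1) y in \<open>auto simp: Suc_le_eq\<close>)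
  have "T 0 = UNIV"
  proof (rule inc_induct[of 0 n])
    show "T i = UNIV" if "i < n" "T (Suc i) = UNIV" for i
      using gen[of "T i"] T(3)[of i] up[of i] that by simp
  qed (use T in auto)
  then show ?thesis using T by simp
qed

section \<open>Elements spanning ideals, and centralizers\<close>

definition scalar_elements :: "'a set" where
  "scalar_elements = {a. \<forall>x. \<exists>c. bracket x a = c *s a}"

definition centralizer :: "'a set \<Rightarrow> 'a set" where
  "centralizer A = {z. \<forall>a\<in>A. bracket z a = 0}"

lemma scalar_elements_iff: "a \<in> scalar_elements \<longleftrightarrow> ideal (span {a})"
proof
  assume a: "a \<in> scalar_elements"
  have "bracket x (k *s a) \<in> span {a}" for x k
  proof -
    obtain c where "bracket x a = c *s a" using a by (auto simp: scalar_elements_def)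
    then show ?thesis by (simp add: bracket_scale_right span_scale span_base)
  qed
  then show "ideal (span {a})"
    unfolding ideal_of_def using subspace_span[of "{a}"] by (auto simp: span_singleton)
next
  assume "ideal (span {a})"
  then have "bracket x a \<in> span {a}" for x by (simp add: ideal_of_def span_base)
  then show "a \<in> scalar_elements" by (auto simp: scalar_elements_def span_singleton)
qed

text \<open>Antisymmetry turns the two scalar relations into c y = - d x. Either c = 0, or y is a
  multiple of x; the bracket vanishes in both cases.\<close>

lemma abelian_scalar_elements: "abelian scalar_elements"
  unfolding abelian_def
proof (intro ballI)
  fix x y assume "x \<in> scalar_elements" "y \<in> scalar_elements"
  then obtain c d where cd: "bracket x y = c *s y" "bracket y x = d *s x"
    unfolding scalar_elements_def by blast
  show "bracket x y = 0"
  proof (cases "c = 0")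
    case False
    then have "y = (1 / c) *s bracket x y" using cd by simp
    also have "\<dots> = (- d / c) *s x" using bracket_anti[of x y] cd by simp
    finally have "y = (- d / c) *s x" .
    then show ?thesis by (metis bracket_scale_right bracket_self scale_zero_right)
  qed (use cd in simp)
qed

text \<open>By the Jacobi identity, [a,[x,z]] is a combination of [x,[z,a]] and [z,[a,x]]. Both
  vanish, since z centralizes \<open>A\<close> and [a,x] is again in \<open>A\<close>.\<close>

lemma ideal_centralizer:
  assumes "ideal A"
  shows "ideal (centralizer A)"
  unfolding ideal_of_def
proof (intro conjI ballI)
  show "subspace (centralizer A)"
    by (rule subspaceI)
      (auto simp: centralizer_def bracket_add_left bracket_scale_left bracket_zero_left)
  fix x z assume z: "z \<in> centralizer A"
  have "bracket (bracket x z) a = 0" if a: "a \<in> A" for a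
  proof -
    have xa: "bracket x a \<in> A" using assms a by (simp add: ideal_of_def)
    have "bracket z (bracket a x) = - bracket z (bracket x a)"
      using bracket_anti[of a x] bracket_scale_right[of z "- 1" "bracket x a"] by simp
    then have "bracket z (bracket a x) = 0" "bracket z a = 0"
      using z a xa by (auto simp: centralizer_def)
    then have "bracket a (bracket x z) = 0"
      using jacobi[of a x z] by (simp add: bracket_zero_right)
    then show ?thesis using bracket_anti[of "bracket x z" a] by simp
  qed
  then show "bracket x z \<in> centralizer A" by (simp add: centralizer_def)
qed simp

text \<open>Every element of L sends each vector of \<open>S\<close> to a multiple of itself, which
  stays in the subspace.\<close>

lemma scalar_elements_subspace_ideal:
  assumes "subspace S" "S \<subseteq> scalar_elements"
  shows "ideal S"
  unfolding ideal_of_def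
proof (intro conjI ballI)
  fix x a assume a: "a \<in> S"
  then obtain c where "bracket x a = c *s a" using assms by (auto simp: scalar_elements_def)
  then show "bracket x a \<in> S" using assms a subspace_scale by simp
qed (use assms in auto)

section \<open>Scalar elements when abelian subideals are ideals\<close>

context
  assumes abelian_subideals: "\<And>S. subideal S \<Longrightarrow> abelian S \<Longrightarrow> ideal S"
begin

text \<open>The assumption on abelian subideals is applied here, to lines; the later arguments use
  it by showing that some line is a subideal.\<close>

lemma scalar_elements_if_subideal: "subideal (span {x}) \<Longrightarrow> x \<in> scalar_elements"
  by (simp add: abelian_subideals abelian_span_singleton scalar_elements_iff)

text \<open>Brackets inside \<open>A\<close> are zero, so each line in \<open>A\<close> is an ideal
  of \<open>A\<close> and therefore a subideal of L.\<close>

lemma abelian_ideal_subset_scalar_elements: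
  assumes A: "ideal A" "abelian A"
  shows "A \<subseteq> scalar_elements"
proof
  fix x assume x: "x \<in> A"
  have s: "subspace A" using A by (simp add: ideal_of_def)
  have "ideal_of (span {x}) A"
    unfolding ideal_of_def
  proof (intro conjI ballI)
    show sub: "span {x} \<subseteq> A" using s x by (intro span_minimal) auto
    show "bracket y z \<in> span {x}" if "y \<in> A" "z \<in> span {x}" for y z
      using that sub A by (simp add: abelian_def span_zero subset_iff)
  qed (simp add: subspace_span)
  then show "x \<in> scalar_elements"
    using scalar_elements_if_subideal subideal_step subideal_if_ideal A by blast
qed

text \<open>The point is closure under sums. The span \<open>?B\<close> of two scalar elements is an
  ideal, and it is abelian because they commute; an abelian ideal consists of scalar
  elements.\<close>

lemma subspace_scalar_elements: "subspace scalar_elements"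
proof (rule subspaceI)
  show "0 \<in> scalar_elements" by (simp add: scalar_elements_def bracket_zero_right)
  show "c *s x \<in> scalar_elements" if "x \<in> scalar_elements" for c x
    unfolding scalar_elements_def
  proof (intro CollectI allI)
    fix l
    obtain d where "bracket l x = d *s x"
      using \<open>x \<in> scalar_elements\<close> by (auto simp: scalar_elements_def)
    then have "bracket l (c *s x) = d *s c *s x"
      using scale_left_commute[of c d x] by (simp only: bracket_scale_right)
    then show "\<exists>d. bracket l (c *s x) = d *s c *s x" ..
  qed
  show "x + y \<in> scalar_elements" if xy: "x \<in> scalar_elements" "y \<in> scalar_elements" for x y
  proof -
    let ?B = "{a *s x + b *s y |a b. True}"
    have "ideal ?B"
      unfolding ideal_of_def
    proof (intro conjI ballI)
      show "subspace ?B"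
      proof (rule subspaceI)
        have "0 = 0 *s x + 0 *s y" by simp
        then show "0 \<in> ?B" by blast
        fix u v assume "u \<in> ?B" "v \<in> ?B"
        then obtain a b c d where "u = a *s x + b *s y" "v = c *s x + d *s y" by blast
        then have "u + v = (a + c) *s x + (b + d) *s y" by (simp add: scale_left_distrib ac_simps)
        then show "u + v \<in> ?B" by blast
      next
        fix c u assume "u \<in> ?B"
        then obtain a b where "u = a *s x + b *s y" by blast
        then have "c *s u = (c * a) *s x + (c * b) *s y" by (simp add: scale_right_distrib)
        then show "c *s u \<in> ?B" by blast
      qed
      fix l u assume "u \<in> ?B"
      then obtain a b where u: "u = a *s x + b *s y" by blast
      obtain c d where "bracket l x = c *s x" "bracket l y = d *s y"
        using xy unfolding scalar_elements_def by blast
      then have "bracket l u = (a * c) *s x + (b * d) *s y"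
        by (simp add: u bracket_add_right bracket_scale_right)
      then show "bracket l u \<in> ?B" by blast
    qed simp
    moreover have "bracket x y = 0" "bracket y x = 0"
      using xy abelian_scalar_elements by (auto simp: abelian_def)
    then have "abelian ?B"
      by (auto simp: abelian_def bracket_add_right bracket_scale_right bracket_add_left
          bracket_scale_left bracket_self)
    ultimately have "?B \<subseteq> scalar_elements" by (rule abelian_ideal_subset_scalar_elements)
    moreover have "x + y = 1 *s x + 1 *s y" by simp
    then have "x + y \<in> ?B" by blast
    ultimately show ?thesis by blast
  qed
qed

lemma ideal_scalar_elements: "ideal scalar_elements"
  by (rule scalar_elements_subspace_ideal[OF subspace_scalar_elements subset_refl])

text \<open>In \<open>scalar_elements\<close> the scalar may vary with the element acted on. Since
  sums are again scalar elements, it is forced to be the same for all of them.\<close>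

lemma scalar_action: "\<exists>c. \<forall>a\<in>scalar_elements. bracket x a = c *s a"
proof (cases "scalar_elements \<subseteq> {0}")
  case True
  then have "bracket x a = 0 *s a" if "a \<in> scalar_elements" for a
    using that bracket_zero_right[of x] by auto
  then show ?thesis by blast
next
  case False
  then obtain e where e: "e \<in> scalar_elements" "e \<noteq> 0" by blast
  then obtain c where c: "bracket x e = c *s e" by (auto simp: scalar_elements_def)
  have "bracket x b = c *s b" if b: "b \<in> scalar_elements" for b
  proof -
    obtain d where d: "bracket x b = d *s b" using b by (auto simp: scalar_elements_def)
    have "e + b \<in> scalar_elements" using e b subspace_scalar_elements subspace_add by blast
    then obtain g where g: "bracket x (e + b) = g *s (e + b)" by (auto simp: scalar_elements_def)
    \<comment> \<open>This compares the scalar g on \<open>e + b\<close> with c on \<open>e\<close>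
      and d on \<open>b\<close>. If d = g, then g = c because \<open>e\<close> is nonzero; otherwise
      \<open>b\<close> is a multiple of \<open>e\<close> and inherits its scalar.\<close>
    have eq: "(d - g) *s b = (g - c) *s e"
      using g unfolding bracket_add_right c d
      by (simp add: algebra_simps)
    show ?thesis
    proof (cases "d = g")
      case True
      then show ?thesis using eq e d by simp
    next
      case False
      then have "b = (1 / (d - g)) *s ((d - g) *s b)" by simp
      also have "\<dots> = ((g - c) / (d - g)) *s e" by (simp add: eq)
      finally obtain k where k: "b = k *s e" by blast
      show ?thesis unfolding k by (simp add: bracket_scale_right c mult.commute)
    qed
  qed
  then show ?thesis by blast
qed

section \<open>The centralizer of the scalar elements\<close>

lemma mem_scalar_elements_if_abelian_modulo:
  assumes V: "ideal V" and x: "x \<in> V" "x \<in> centralizer scalar_elements"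
    and comm: "\<And>y z. y \<in> V \<inter> centralizer scalar_elements \<Longrightarrow>
      z \<in> V \<inter> centralizer scalar_elements \<Longrightarrow> bracket y z \<in> scalar_elements"
  shows "x \<in> scalar_elements"
proof -
  let ?A = scalar_elements and ?C = "centralizer scalar_elements"
  \<comment> \<open>\<open>?M\<close> is the middle term of the chain \<open>span {x}\<close>,
    \<open>?M\<close>, \<open>V \<inter> ?C\<close>, L, which makes the line through
    \<open>x\<close> a subideal. Only the part of \<open>?A\<close> inside \<open>V\<close> is
    added, so that \<open>?M\<close> stays in \<open>V \<inter> ?C\<close>.\<close>
  let ?M = "{c *s x + a |c a. a \<in> V \<inter> ?A}"
  have sV: "subspace V" using V by (simp add: ideal_of_def)
  have C: "ideal ?C" by (rule ideal_centralizer[OF ideal_scalar_elements])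
  have sA: "subspace (V \<inter> ?A)" by (rule subspace_inter[OF sV subspace_scalar_elements])
  have sC: "subspace ?C" using C by (simp add: ideal_of_def)
  have AC: "?A \<subseteq> ?C" using abelian_scalar_elements by (auto simp: abelian_def centralizer_def)
  have N: "ideal (V \<inter> ?C)"
    using V C by (auto simp: ideal_of_def intro: subspace_inter)
  have "ideal_of ?M (V \<inter> ?C)"
    unfolding ideal_of_def
  proof (intro conjI ballI)
    show sub: "?M \<subseteq> V \<inter> ?C"
      using x AC sV sC by (auto intro!: subspace_add subspace_scale)
    show "subspace ?M"
    proof (rule subspaceI)
      have "0 = 0 *s x + 0" "0 \<in> V \<inter> ?A" using sA subspace_0 by auto
      then show "0 \<in> ?M" by blast
      fix u v assume "u \<in> ?M" "v \<in> ?M"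
      then obtain c a d b where ab: "u = c *s x + a" "v = d *s x + b"
        "a \<in> V \<inter> ?A" "b \<in> V \<inter> ?A" by blast
      then have "u + v = (c + d) *s x + (a + b)" "a + b \<in> V \<inter> ?A"
        using subspace_add[OF sA] by (simp_all add: scale_left_distrib)
      then show "u + v \<in> ?M" by blast
    next
      fix k u assume "u \<in> ?M"
      then obtain c a where "u = c *s x + a" "a \<in> V \<inter> ?A" by blast
      then have "k *s u = (k * c) *s x + k *s a" "k *s a \<in> V \<inter> ?A"
        using subspace_scale[OF sA] by (simp_all add: scale_right_distrib)
      then show "k *s u \<in> ?M" by blast
    qed
    fix y u assume y: "y \<in> V \<inter> ?C" and u: "u \<in> ?M"
    have "bracket y u \<in> V" using N y u sub unfolding ideal_of_def by blast
    moreover have "bracket y u \<in> ?A" using comm y u sub by blast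
    \<comment> \<open>The product lies in \<open>V \<inter> ?A\<close>, hence in \<open>?M\<close>
      with coefficient 0 at \<open>x\<close>.\<close>
    moreover have "bracket y u = 0 *s x + bracket y u" by simp
    ultimately show "bracket y u \<in> ?M" by blast
  qed
  moreover have "ideal_of (span {x}) ?M"
    unfolding ideal_of_def
  proof (intro conjI ballI)
    have "c *s x = c *s x + 0" "0 \<in> V \<inter> ?A" for c using sA subspace_0 by auto
    then have "c *s x \<in> ?M" for c by blast
    then show "span {x} \<subseteq> ?M" by (auto simp only: span_singleton)
    fix u v assume "u \<in> ?M" "v \<in> span {x}"
    then obtain c a d where ca: "u = c *s x + a" "a \<in> ?A" "v = d *s x"
      by (auto simp: span_singleton)
    \<comment> \<open>Since \<open>x\<close> centralizes \<open>?A\<close>, it commutes with all of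
      \<open>?M\<close>; its line is central there.\<close>
    have "bracket a x = 0" using x(2) ca(2) bracket_anti[of a x] by (auto simp: centralizer_def)
    then have "bracket u v = 0"
      by (simp add: ca bracket_add_left bracket_scale_left bracket_scale_right bracket_self)
    then show "bracket u v \<in> span {x}" by (simp add: span_zero)
  qed (simp add: subspace_span)
  ultimately show ?thesis
    using N subideal_step subideal_if_ideal scalar_elements_if_subideal by blast
qed

text \<open>Transfinite induction along the series shows that each term meets the centralizer inside
  the scalar elements; the greatest index, where the term is L, gives the claim.\<close>

lemma centralizer_scalar_elements:
  assumes hyperabelian
  shows "centralizer scalar_elements \<subseteq> scalar_elements"
proof -
  let ?A = scalar_elements and ?C = "centralizer scalar_elements"
  obtain r :: "'a set rel" and V where s: "abelian_ideal_series r V"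
    using assms unfolding hyperabelian_def by blast
  have wo: "wo_rel r" using s by (simp add: abelian_ideal_series_def wo_rel_def)
  have C: "ideal ?C" by (rule ideal_centralizer[OF ideal_scalar_elements])
  note series = s[unfolded abelian_ideal_series_def, THEN conjunct2]
  note series' = series[THEN conjunct2, THEN conjunct2]
  have id: "\<And>i. i \<in> Field r \<Longrightarrow> ideal (V i)"
    using series[THEN conjunct1] by simp
  have "k \<in> Field r \<longrightarrow> V k \<inter> ?C \<subseteq> ?A" for k
  proof (rule wo_rel.well_order_induct[OF wo, where P = "\<lambda>k. k \<in> Field r \<longrightarrow> V k \<inter> ?C \<subseteq> ?A"],
      rule impI)
    fix k assume IH: "\<forall>j. j \<noteq> k \<and> (j, k) \<in> r \<longrightarrow> j \<in> Field r \<longrightarrow> V j \<inter> ?C \<subseteq> ?A"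
      and k: "k \<in> Field r"
    have below: "V j \<inter> ?C \<subseteq> ?A" if "j \<in> underS r k" for j
      using IH that by (auto simp: underS_def Field_def)
    \<comment> \<open>The cases are the least index, a successor of i, and a limit index.\<close>
    consider "underS r k = {}" | i where "i \<in> Field r" "underS r k = under r i"
      | "underS r k \<noteq> {} \<and> \<not> (\<exists>i\<in>Field r. underS r k = under r i)" by blast
    then show "V k \<inter> ?C \<subseteq> ?A"
    proof cases
      case 1
      then have "V k = {0}" using series[THEN conjunct2, THEN conjunct1] k by simp
      then show ?thesis using subspace_0[OF subspace_scalar_elements] by auto
    next
      case 2
      have "abelian_factor (V k) (V i)"
        using series'[THEN conjunct1] k 2 by simp
      then have fac: "\<And>y z. y \<in> V k \<Longrightarrow> z \<in> V k \<Longrightarrow> bracket y z \<in> V i"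
        using id[OF 2(1)] by (simp add: abelian_factor_iff ideal_of_def)
      have "(i, i) \<in> r" using wo_rel.REFL[OF wo] 2(1) by (auto simp: refl_on_def)
      then have Vi: "V i \<inter> ?C \<subseteq> ?A" using below 2 by (simp add: under_def)
      show ?thesis
      proof
        fix x assume "x \<in> V k \<inter> ?C"
        \<comment> \<open>The product lies in \<open>V i\<close> because the factor is abelian, and
          in \<open>?C\<close> because \<open>?C\<close> is an ideal; the induction hypothesis at i
          then places it in \<open>?A\<close>.\<close>
        moreover have "bracket y z \<in> ?A" if "y \<in> V k \<inter> ?C" "z \<in> V k \<inter> ?C" for y z
          using that fac Vi C unfolding ideal_of_def by blast
        ultimately show "x \<in> ?A"
          using mem_scalar_elements_if_abelian_modulo[OF id[OF k]] by blast
      qed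
    next
      case 3
      then have "V k = (\<Union>i\<in>underS r k. V i)"
        using series'[THEN conjunct2, THEN conjunct1] k by blast
      then show ?thesis using below by blast
    qed
  qed
  moreover obtain m where "m \<in> Field r" "V m = UNIV"
    using series'[THEN conjunct2, THEN conjunct2] by blast
  ultimately show ?thesis by (metis Int_UNIV_left)
qed

section \<open>Ideals generated outside the scalar elements, and the conclusion for
  subideals\<close>

lemma ideal_eq_UNIV:
  assumes hyperabelian and y: "y \<notin> scalar_elements" and I: "ideal I" "y \<in> I"
  shows "I = UNIV"
proof -
  let ?A = scalar_elements
  have sI: "subspace I" using I by (simp add: ideal_of_def)
  obtain c where c: "\<And>a. a \<in> ?A \<Longrightarrow> bracket y a = c *s a" using scalar_action by blast
  have CA: "centralizer ?A \<subseteq> ?A" by (rule centralizer_scalar_elements[OF assms(1)])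
  \<comment> \<open>If \<open>y\<close> acted as zero it would centralize \<open>?A\<close>, and so
    lie in \<open>?A\<close>.\<close>
  have c0: "c \<noteq> 0"
  proof
    assume "c = 0"
    then have "y \<in> centralizer ?A" using c by (simp add: centralizer_def)
    then show False using CA y by blast
  qed
  \<comment> \<open>The ideal contains c a = - [a,y], and c is invertible.\<close>
  have AI: "a \<in> I" if a: "a \<in> ?A" for a
  proof -
    have "- bracket a y \<in> I" using I subspace_neg[OF sI] by (simp add: ideal_of_def)
    then have "c *s a \<in> I" using c[OF a] bracket_anti[of y a] by simp
    then have "(1 / c) *s (c *s a) \<in> I" by (rule subspace_scale[OF sI])
    then show ?thesis using c0 by simp
  qed
  have "l \<in> I" for l
  proof -
    obtain d where d: "\<And>a. a \<in> ?A \<Longrightarrow> bracket l a = d *s a" using scalar_action by blast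
    \<comment> \<open>The coefficient d / c makes the action of \<open>y\<close> cancel the scalar d
      by which \<open>l\<close> acts. The difference thus centralizes \<open>?A\<close>, so it lies
      in \<open>?A\<close> and hence in \<open>I\<close>.\<close>
    have "l - (d / c) *s y \<in> centralizer ?A"
      using c0 by (simp add: centralizer_def bracket_diff_left bracket_scale_left c d)
    then have "l - (d / c) *s y \<in> I" using CA AI by blast
    then have "(l - (d / c) *s y) + (d / c) *s y \<in> I"
      using subspace_add[OF sI] subspace_scale[OF sI I(2)] by blast
    then show ?thesis by simp
  qed
  then show ?thesis by blast
qed

text \<open>A subideal of scalar elements is invariant because L acts by scalars; any other contains
  some \<open>y\<close> that generates L as an ideal, and then its chain collapses to L.\<close>

lemma subideal_imp_ideal:
  assumes hyperabelian and S: "subideal S"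
  shows "ideal S"
proof (cases "S \<subseteq> scalar_elements")
  case True
  then show ?thesis by (rule scalar_elements_subspace_ideal[OF subideal_subspace[OF S]])
next
  case False
  then obtain y where "y \<in> S" "y \<notin> scalar_elements" by blast
  then have "S = UNIV" using subideal_eq_UNIV[OF S] ideal_eq_UNIV[OF assms(1)] by blast
  then show ?thesis by (simp add: ideal_of_def)
qed

end

end

theorem corollaryB1:
  fixes scale :: "'f::field \<Rightarrow> 'a::ab_group_add \<Rightarrow> 'a"
    and bracket :: "'a \<Rightarrow> 'a \<Rightarrow> 'a"
  assumes "lie_algebra scale bracket"
    and "lie_algebra.hyperabelian scale bracket"
  shows "(\<forall>S. lie_algebra.subideal scale bracket S \<and> lie_algebra.abelian bracket S \<longrightarrow>
            lie_algebra.ideal scale bracket S) \<longleftrightarrow>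
         (\<forall>S. lie_algebra.subideal scale bracket S \<longrightarrow> lie_algebra.ideal scale bracket S)"
  using lie_algebra.subideal_imp_ideal[OF assms(1) _ assms(2)] by blast

end
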